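(* Let $n\ge1$ and $0\le i,j,k\le n$. The number of involutions $\sigma\in S_n$ avoiding $321$ with $\mathrm{fp}(\sigma)=i$, $\mathrm{exc}(\sigma)=j$ and $\ell(\sigma)=k$ equals the number of involutions $\sigma\in S_n$ avoiding $132$ with $\mathrm{fp}(\sigma)=i$, $\mathrm{exc}(\sigma)=j$ and $\mathrm{rk}(\sigma)=n-k$.
   Context: An involution is a permutation with $\sigma=\sigma^{-1}$. Pattern avoidance: $\sigma$ avoids $321$ if there are no $a<b<c$ with $\sigma(a)>\sigma(b)>\sigma(c)$, and avoids $132$ if there are no $a<b<c$ with $\sigma(a)<\sigma(c)<\sigma(b)$. $\mathrm{fp}(\sigma)=\#\{i:\sigma(i)=i\}$, $\mathrm{exc}(\sigma)=\#\{i:\sigma(i)>i\}$, $\ell(\sigma)$ is the length of the longest increasing subsequence, and $\mathrm{rk}(\sigma)$ is the largest $k\ge0$ such that $\sigma(i)>k$ for all $i\le k$. *)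

theory Defs
  imports "HOL-Combinatorics.Permutations"
begin

(* Elements of S_n are functions s with "s permutes {1..n}": bijections of nat that fix every
   point outside {1..n}.  All statistics are therefore restricted to {1..n}. *)

definition is_involution :: "nat \<Rightarrow> (nat \<Rightarrow> nat) \<Rightarrow> bool" where
  "is_involution n s \<longleftrightarrow> s permutes {1..n} \<and> s = inv s"

definition avoids_321 :: "nat \<Rightarrow> (nat \<Rightarrow> nat) \<Rightarrow> bool" where
  "avoids_321 n s \<longleftrightarrow>
     \<not> (\<exists>a\<in>{1..n}. \<exists>b\<in>{1..n}. \<exists>c\<in>{1..n}. a < b \<and> b < c \<and> s a > s b \<and> s b > s c)"

definition avoids_132 :: "nat \<Rightarrow> (nat \<Rightarrow> nat) \<Rightarrow> bool" where
  "avoids_132 n s \<longleftrightarrow>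
     \<not> (\<exists>a\<in>{1..n}. \<exists>b\<in>{1..n}. \<exists>c\<in>{1..n}. a < b \<and> b < c \<and> s a < s c \<and> s c < s b)"

definition fp :: "nat \<Rightarrow> (nat \<Rightarrow> nat) \<Rightarrow> nat" where
  "fp n s = card {i \<in> {1..n}. s i = i}"

definition exc :: "nat \<Rightarrow> (nat \<Rightarrow> nat) \<Rightarrow> nat" where
  "exc n s = card {i \<in> {1..n}. s i > i}"

(* A subsequence is represented by its set A of positions. *)
definition lis :: "nat \<Rightarrow> (nat \<Rightarrow> nat) \<Rightarrow> nat" where
  "lis n s = Max {card A | A. A \<subseteq> {1..n} \<and> strict_mono_on A s}"

(* The condition holds vacuously for k = 0, so the maximum is over a nonempty finite set. *)
definition rk :: "nat \<Rightarrow> (nat \<Rightarrow> nat) \<Rightarrow> nat" where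
  "rk n s = Max {k. k \<le> n \<and> (\<forall>i\<in>{1..k}. s i > k)}"

end

theory Submission
  imports Defs
begin

text \<open>
  In an involution the fixed points and excedances satisfy \<open>fp + 2 exc = n\<close>. A 321-avoiding
  involution has longest increasing subsequence of length \<open>n - exc\<close> (its weak excedances form
  one, and no increasing subsequence meets a 2-cycle twice), while a 132-avoiding one has rank
  \<open>exc\<close>. So it suffices to count both classes by the number of 2-cycles. Both counts,
  refined by the position of the first anti-excedance \<open>d\<close> and by the value \<open>s 1 = m\<close>
  respectively, with \<open>d + m = n + 2\<close>, satisfy the same recurrence: remove the 2-cycle through
  \<open>d\<close>, respectively through \<open>1\<close>.
\<close>

section \<open>Involutions and their statistics\<close>

lemma is_involution_iff:
  "is_involution n s \<longleftrightarrow> (\<forall>x. s (s x) = x) \<and> (\<forall>x. x \<notin> {1..n} \<longrightarrow> s x = x)"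
proof
  assume "is_involution n s"
  then have p: "s permutes {1..n}" and i: "s = inv s" by (auto simp: is_involution_def)
  have "s (s x) = x" for x
    using permutes_inverses(1)[OF p, of x] i by metis
  then show "(\<forall>x. s (s x) = x) \<and> (\<forall>x. x \<notin> {1..n} \<longrightarrow> s x = x)"
    using p by (simp add: permutes_def)
next
  assume *: "(\<forall>x. s (s x) = x) \<and> (\<forall>x. x \<notin> {1..n} \<longrightarrow> s x = x)"
  then have "s permutes {1..n}" unfolding permutes_def by metis
  moreover have "inv s = s" using * by (intro inv_unique_comp) auto
  ultimately show "is_involution n s" by (simp add: is_involution_def)
qed

lemma involution_invol: "is_involution n s \<Longrightarrow> s (s x) = x"
  and involution_outside: "is_involution n s \<Longrightarrow> x \<notin> {1..n} \<Longrightarrow> s x = x"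
  and involution_0: "is_involution n s \<Longrightarrow> s 0 = 0"
  by (auto simp: is_involution_iff)

lemma involution_in_iff:
  assumes "is_involution n s" shows "s x \<in> {1..n} \<longleftrightarrow> x \<in> {1..n}"
  using assms unfolding is_involution_iff by metis

lemma involution_eq_iff: "is_involution n s \<Longrightarrow> s x = s y \<longleftrightarrow> x = y"
  by (metis involution_invol)

lemma finite_involutions: "finite {s. is_involution n s \<and> P s}"
  by (rule finite_subset[OF _ finite_permutations[of "{1..n}"]])
     (auto simp: is_involution_def)

lemma exc_involution:
  assumes "is_involution n s" shows "exc n s = card {x. x < s x}"
proof -
  have "{x \<in> {1..n}. s x > x} = {x. x < s x}"
    using involution_outside[OF assms] by force
  then show ?thesis by (simp add: exc_def)
qed

lemma finite_exc:
  assumes "is_involution n s" shows "finite {x. x < s x}"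
  by (rule finite_subset[of _ "{1..n}"]) (use involution_outside[OF assms] in force)+

lemma exc_eq_0_iff:
  assumes "is_involution n s" shows "exc n s = 0 \<longleftrightarrow> s = id"
proof
  assume "exc n s = 0"
  then have "\<not> x < s x" for x
    using finite_exc[OF assms] exc_involution[OF assms] by auto
  then have "s x = x" for x
    by (metis involution_invol[OF assms] linorder_less_linear)
  then show "s = id" by auto
qed (simp add: exc_def)

text \<open>\<open>s\<close> itself is the bijection: it swaps the two points of every 2-cycle, so
  it exchanges anti-excedances and excedances.\<close>

lemma card_anti_exc:
  assumes "is_involution n s" shows "card {x \<in> {1..n}. s x < x} = exc n s"
proof -
  have "bij_betw s {x \<in> {1..n}. s x < x} {x \<in> {1..n}. s x > x}"
    by (rule bij_betw_byWitness[where f' = s])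
       (use involution_invol[OF assms] involution_in_iff[OF assms] in auto)
  then show ?thesis using bij_betw_same_card by (force simp: exc_def)
qed

lemma card_weak_exc:
  assumes "is_involution n s" shows "card {x \<in> {1..n}. x \<le> s x} = n - exc n s"
    and "exc n s \<le> n"
proof -
  have "{x \<in> {1..n}. x \<le> s x} = {1..n} - {x \<in> {1..n}. s x < x}" by auto
  then show "card {x \<in> {1..n}. x \<le> s x} = n - exc n s"
    using card_anti_exc[OF assms] card_Diff_subset[of "{x \<in> {1..n}. s x < x}" "{1..n}"] by fastforce
  show "exc n s \<le> n"
    unfolding exc_def using card_mono[of "{1..n}" "{i \<in> {1..n}. s i > i}"] by fastforce
qed

lemma fp_exc:
  assumes "is_involution n s" shows "fp n s + 2 * exc n s = n"
proof -
  have "card {1..n} = card (({x \<in> {1..n}. s x = x} \<union> {x \<in> {1..n}. s x > x}) \<union> {x \<in> {1..n}. s x < x})"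
    by (rule arg_cong[where f = card]) auto
  also have "\<dots> = fp n s + exc n s + exc n s"
    using card_anti_exc[OF assms]
    by (subst card_Un_disjoint, simp, simp, force, subst card_Un_disjoint, simp, simp, force)
       (simp add: fp_def exc_def)
  finally show ?thesis by simp
qed

text \<open>In terms of arcs joining \<open>x\<close> to \<open>s x\<close>: no arc is nested in another, and no fixed
  point lies below an arc.\<close>

lemma avoids_321_iff:
  assumes inv: "is_involution n s"
  shows "avoids_321 n s \<longleftrightarrow> (\<forall>x y. x < y \<longrightarrow> y \<le> s y \<longrightarrow> s x < s y)"
proof
  assume av: "avoids_321 n s"
  show "\<forall>x y. x < y \<longrightarrow> y \<le> s y \<longrightarrow> s x < s y"
  proof (intro allI impI, rule ccontr)
    fix x y assume xy: "x < y" "y \<le> s y" "\<not> s x < s y"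
    then have lt: "s y < s x" using involution_eq_iff[OF inv, of x y] by auto
    then have "x < s x" using xy by simp
    then have x: "x \<in> {1..n}" using involution_outside[OF inv, of x] by force
    then have sx: "s x \<in> {1..n}" using involution_in_iff[OF inv] by simp
    have y: "y \<in> {1..n}" "s y \<in> {1..n}" using x sx xy lt by auto
    \<comment> \<open>A fixed point \<open>y\<close> gives the pattern at positions
      \<open>x < y < s x\<close>, an excedance \<open>y\<close> gives it at
      \<open>x < y < s y\<close>.\<close>
    show False
    proof (cases "s y = y")
      case True
      then show False using av x y sx xy lt involution_invol[OF inv, of x]
        unfolding avoids_321_def by (metis (no_types))
    next
      case False
      then have "y < s y" using xy by simp
      then show False using av x y sx xy lt involution_invol[OF inv, of y]
        unfolding avoids_321_def by (metis (no_types))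
    qed
  qed
next
  assume *: "\<forall>x y. x < y \<longrightarrow> y \<le> s y \<longrightarrow> s x < s y"
  show "avoids_321 n s" unfolding avoids_321_def
  proof clarify
    fix a b c assume abc: "a < b" "b < c" "s b < s a" "s c < s b"
    \<comment> \<open>The middle entry of a pattern cannot be a weak excedance, so
      \<open>s b\<close> is an excedance. The hypothesis at \<open>s c < s b\<close> then yields
      \<open>c < b\<close>.\<close>
    have "s b < b" using * abc by (metis not_less_iff_gr_or_eq linorder_not_le)
    then have "s (s c) < s (s b)"
      using * abc involution_invol[OF inv, of b] by (metis less_imp_le)
    then show False using abc involution_invol[OF inv] by simp
  qed
qed

lemma avoids_132_iff:
  assumes inv: "is_involution n s"
  shows "avoids_132 n s \<longleftrightarrow> (\<forall>x y z. 0 < x \<longrightarrow> x < y \<longrightarrow> y < z \<longrightarrow> s x < s z \<longrightarrow> s y \<le> s z)"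
proof -
  have z: "z \<in> {1..n}" if "0 < x" "x < y" "y < z" "s z < s y" for x y z
  proof (rule ccontr)
    assume "z \<notin> {1..n}"
    then have "s z = z" "z > n" using involution_outside[OF inv, of z] that by auto
    then show False
      using that involution_in_iff[OF inv, of y] involution_outside[OF inv, of y]
      by (cases "y \<in> {1..n}") auto
  qed
  have range: "x \<in> {1..n}" "y \<in> {1..n}" "z \<in> {1..n}"
    if "0 < x" "x < y" "y < z" "s z < s y" for x y z
    using z[OF that] that by auto
  show ?thesis
  proof (intro iffI allI impI)
    fix x y z assume *: "avoids_132 n s" "0 < x" "x < y" "y < z" "s x < s z"
    show "s y \<le> s z"
    proof (rule ccontr)
      assume "\<not> s y \<le> s z"
      then have "s z < s y" by simp
      then show False using range[OF *(2-4)] * unfolding avoids_132_def by blast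
    qed
  next
    assume *: "\<forall>x y z. 0 < x \<longrightarrow> x < y \<longrightarrow> y < z \<longrightarrow> s x < s z \<longrightarrow> s y \<le> s z"
    show "avoids_132 n s" unfolding avoids_132_def
    proof clarify
      fix a b c assume abc: "a \<in> {1..n}" "a < b" "b < c" "s a < s c" "s c < s b"
      then have "0 < a" by simp
      then show False using *[rule_format, OF _ abc(2-4)] abc(5) by (meson not_less)
    qed
  qed
qed

section \<open>Longest increasing subsequence and rank in terms of excedances\<close>

lemma lis_321:
  assumes inv: "is_involution n s" and av: "avoids_321 n s"
  shows "lis n s = n - exc n s"
  unfolding lis_def
proof (rule Max_eqI)
  let ?W = "{x \<in> {1..n}. x \<le> s x}"
  have "{card A |A. A \<subseteq> {1..n} \<and> strict_mono_on A s} \<subseteq> card ` Pow {1..n}" by auto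
  then show "finite {card A |A. A \<subseteq> {1..n} \<and> strict_mono_on A s}"
    by (rule finite_subset) simp
  show "n - exc n s \<in> {card A |A. A \<subseteq> {1..n} \<and> strict_mono_on A s}"
    using av card_weak_exc(1)[OF inv]
    by (auto simp: avoids_321_iff[OF inv] strict_mono_on_def intro!: exI[of _ ?W])
  fix c assume "c \<in> {card A |A. A \<subseteq> {1..n} \<and> strict_mono_on A s}"
  then obtain A where A: "c = card A" "A \<subseteq> {1..n}" "strict_mono_on A s" by auto
  \<comment> \<open>an increasing subsequence contains at most one point of each 2-cycle\<close>
  have no2: "s x \<notin> A" if "x \<in> A" "s x \<noteq> x" for x
  proof
    assume "s x \<in> A"
    then show False using that strict_mono_onD[OF A(3), of x "s x"]
        strict_mono_onD[OF A(3), of "s x" x] involution_invol[OF inv, of x]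
      by (cases x "s x" rule: linorder_cases) auto
  qed
  \<comment> \<open>The smaller point of the cycle of \<open>x\<close> identifies that cycle and is
    a weak excedance, so increasing sets inject into \<open>?W\<close>.\<close>
  have "inj_on (\<lambda>x. min x (s x)) A"
  proof
    fix x y assume xy: "x \<in> A" "y \<in> A" "min x (s x) = min y (s y)"
    then have "y = x \<or> y = s x" using involution_invol[OF inv] by (metis min_def)
    then show "x = y" using no2[OF xy(1)] xy(2) by metis
  qed
  moreover have "(\<lambda>x. min x (s x)) ` A \<subseteq> ?W"
  proof
    fix w assume "w \<in> (\<lambda>x. min x (s x)) ` A"
    then obtain x where "x \<in> A" "w = min x (s x)" by auto
    then show "w \<in> ?W" using A(2) involution_in_iff[OF inv, of x] involution_invol[OF inv, of x]
      by (auto simp: min_def split: if_splits)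
  qed
  ultimately have "card A \<le> card ?W" by (intro card_inj_on_le) auto
  then show "c \<le> n - exc n s" using A card_weak_exc(1)[OF inv] by simp
qed

text \<open>In a 132-avoiding involution the excedances occupy an initial segment of positions.\<close>

lemma rk_132:
  assumes inv: "is_involution n s" and av: "avoids_132 n s"
  shows "rk n s = exc n s"
proof -
  let ?E = "{x. x < s x}"
  \<comment> \<open>If \<open>x\<close> were not an excedance, the positions
    \<open>x < y < s y\<close> would carry the values \<open>s x < y < s y\<close> in the order of a
    132 pattern.\<close>
  have dc: "x \<in> ?E" if "y \<in> ?E" "0 < x" "x < y" for x y
  proof (rule ccontr)
    assume "x \<notin> ?E"
    then have sx: "s x \<le> x" by simp
    have "s x < y" "y < s y" using sx that by auto
    then have "s y \<le> s (s y)"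
      using av[unfolded avoids_132_iff[OF inv]] that involution_invol[OF inv, of y] by metis
    then show False using that involution_invol[OF inv, of y] by auto
  qed
  have fin: "finite ?E" by (rule finite_exc[OF inv])
  have no0: "0 \<notin> ?E" using involution_0[OF inv] by simp
  have E: "?E = {1..exc n s}"
  proof (cases "?E = {}")
    case True then show ?thesis using exc_involution[OF inv] by simp
  next
    case False
    have "?E = {1..Max ?E}"
    proof
      show "?E \<subseteq> {1..Max ?E}" using fin no0 by (metis (no_types, lifting) Max_ge atLeastAtMost_iff
        less_one linorder_not_le subsetI)
      show "{1..Max ?E} \<subseteq> ?E"
      proof
        fix x assume "x \<in> {1..Max ?E}"
        then show "x \<in> ?E" using dc[OF Max_in[OF fin False], of x] Max_in[OF fin False]
          by (cases "x = Max ?E") auto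
      qed
    qed
    then show ?thesis using exc_involution[OF inv] by (metis card_atLeastAtMost diff_Suc_1)
  qed
  show ?thesis unfolding rk_def
  proof (rule Max_eqI)
    show "finite {k. k \<le> n \<and> (\<forall>i\<in>{1..k}. k < s i)}" by simp
    show "exc n s \<in> {k. k \<le> n \<and> (\<forall>i\<in>{1..k}. k < s i)}"
    proof (clarsimp simp: card_weak_exc(2)[OF inv])
      fix i assume i: "Suc 0 \<le> i" "i \<le> exc n s"
      then have "i < s i" using E by auto
      \<comment> \<open>The partner of an excedance is an anti-excedance, hence lies beyond the
        initial segment \<open>?E\<close>.\<close>
      moreover then have "s i \<notin> ?E" using involution_invol[OF inv, of i] by simp
      ultimately show "exc n s < s i" unfolding E using i by auto
    qed
    fix k assume k: "k \<in> {k. k \<le> n \<and> (\<forall>i\<in>{1..k}. k < s i)}"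
    then have "{1..k} \<subseteq> ?E" by force
    then have "{1..k} \<subseteq> {1..exc n s}" using E by simp
    then show "k \<le> exc n s" by auto
  qed
qed

section \<open>Inserting a 2-cycle\<close>

text \<open>\<open>skip2 a d\<close> is the increasing enumeration of the naturals other than \<open>a\<close> and \<open>d\<close>,
  provided \<open>a < d\<close>.\<close>

definition skip2 :: "nat \<Rightarrow> nat \<Rightarrow> nat \<Rightarrow> nat" where
  "skip2 a d x = (if x < a then x else if x + 1 < d then x + 1 else x + 2)"

text \<open>\<open>t\<close> is transported along the relabelling \<open>skip2 a d\<close>. The
  inverse is only consulted off \<open>a\<close> and \<open>d\<close>, where
  \<open>skip2 a d\<close> does attain the value \<open>y\<close> if \<open>a < d\<close>.\<close>

definition insert_cycle :: "nat \<Rightarrow> nat \<Rightarrow> (nat \<Rightarrow> nat) \<Rightarrow> nat \<Rightarrow> nat" where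
  "insert_cycle a d t y =
     (if y = a then d else if y = d then a else skip2 a d (t (inv (skip2 a d) y)))"

lemma skip2_mono: "a < d \<Longrightarrow> strict_mono (skip2 a d)"
  by (auto simp: strict_mono_def skip2_def)

lemma skip2_less_iff [simp]: "a < d \<Longrightarrow> skip2 a d x < skip2 a d y \<longleftrightarrow> x < y"
  and skip2_le_iff [simp]: "a < d \<Longrightarrow> skip2 a d x \<le> skip2 a d y \<longleftrightarrow> x \<le> y"
  and skip2_eq_iff [simp]: "a < d \<Longrightarrow> skip2 a d x = skip2 a d y \<longleftrightarrow> x = y"
  by (simp_all add: strict_mono_less strict_mono_less_eq strict_mono_eq skip2_mono)

lemma skip2_neq [simp]:
  "a < d \<Longrightarrow> skip2 a d x \<noteq> a" "a < d \<Longrightarrow> skip2 a d x \<noteq> d"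
  "a < d \<Longrightarrow> a \<noteq> skip2 a d x" "a < d \<Longrightarrow> d \<noteq> skip2 a d x"
  by (auto simp: skip2_def)

lemma skip2_in_iff:
  "0 < a \<Longrightarrow> a < d \<Longrightarrow> d \<le> n + 2 \<Longrightarrow> skip2 a d x \<in> {1..n + 2} \<longleftrightarrow> x \<in> {1..n}"
  by (auto simp: skip2_def split: if_splits)

lemma skip2_cases:
  assumes "a < d"
  obtains "y = a" | "y = d" | x where "y = skip2 a d x"
proof -
  have "y = skip2 a d y" if "y < a" using that by (simp add: skip2_def)
  moreover have "y = skip2 a d (y - 1)" if "a < y" "y < d" using that by (auto simp: skip2_def)
  moreover have "y = skip2 a d (y - 2)" if "d < y" using that assms by (auto simp: skip2_def)
  ultimately show thesis using that by (metis linorder_less_linear)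
qed

lemma insert_cycle_simps [simp]:
  assumes "a < d"
  shows "insert_cycle a d t a = d" "insert_cycle a d t d = a"
    "insert_cycle a d t (skip2 a d x) = skip2 a d (t x)"
  using assms by (auto simp: insert_cycle_def strict_mono_imp_inj_on[OF skip2_mono] inv_f_f)

lemma insert_cycle_inject:
  assumes "a < d" "insert_cycle a d t = insert_cycle a d t'" shows "t = t'"
proof
  fix x
  have "skip2 a d (t x) = skip2 a d (t' x)"
    using assms insert_cycle_simps(3)[OF assms(1)] by metis
  then show "t x = t' x" using assms by simp
qed

lemma insert_cycle_involution:
  assumes "is_involution n t" "0 < a" "a < d" "d \<le> n + 2"
  shows "is_involution (n + 2) (insert_cycle a d t)"
  unfolding is_involution_iff
proof (intro conjI allI impI)
  fix x
  show "insert_cycle a d t (insert_cycle a d t x) = x"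
    using assms by (cases x rule: skip2_cases[OF assms(3)]) (auto simp: involution_invol)
  assume x: "x \<notin> {1..n + 2}"
  show "insert_cycle a d t x = x"
  proof (cases x rule: skip2_cases[OF assms(3)])
    case (3 y)
    then have "y \<notin> {1..n}" using x skip2_in_iff assms by blast
    then show ?thesis using 3 assms involution_outside[OF assms(1)] by simp
  qed (use x assms in auto)
qed

text \<open>Monotone relabelling preserves excedances, and of the two new points only
  \<open>a\<close> is one.\<close>

lemma exc_insert_cycle:
  assumes "is_involution n t" "0 < a" "a < d" "d \<le> n + 2"
  shows "exc (n + 2) (insert_cycle a d t) = Suc (exc n t)"
proof -
  have "{y. y < insert_cycle a d t y} = insert a (skip2 a d ` {x. x < t x})"
  proof (intro set_eqI)
    fix y show "y \<in> {y. y < insert_cycle a d t y} \<longleftrightarrow> y \<in> insert a (skip2 a d ` {x. x < t x})"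
      using assms(3) by (cases y rule: skip2_cases[OF assms(3)]) auto
  qed
  moreover have "card (insert a (skip2 a d ` {x. x < t x})) = Suc (card {x. x < t x})"
    using assms(3) finite_exc[OF assms(1)]
    by (subst card_insert_disjoint)
       (auto simp: card_image strict_mono_imp_inj_on[OF skip2_mono] inj_on_def)
  ultimately show ?thesis
    by (simp add: exc_involution insert_cycle_involution[OF assms] exc_involution[OF assms(1)]
        del: add_2_eq_Suc add_2_eq_Suc')
qed

text \<open>Surjectivity of insertion: \<open>s\<close> swaps \<open>a\<close> and \<open>d\<close>,
  so it preserves the range of \<open>skip2 a d\<close> and can be pulled back to some
  \<open>t\<close>.\<close>

lemma delete_cycle:
  assumes inv: "is_involution (n + 2) s" and ad: "s a = d" "a < d"
  obtains t where "is_involution n t" "s = insert_cycle a d t" "0 < a" "d \<le> n + 2"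
proof -
  have a: "a \<in> {1..n + 2}" using involution_outside[OF inv, of a] ad by force
  then have d: "d \<in> {1..n + 2}" using involution_in_iff[OF inv, of a] ad by simp
  have a0: "0 < a" and dn: "d \<le> n + 2" using a d by auto
  have sd: "s d = a" using involution_invol[OF inv, of a] ad by simp
  have "\<exists>y. s (skip2 a d x) = skip2 a d y" for x
    using ad sd involution_invol[OF inv] skip2_neq
    by (cases "s (skip2 a d x)" rule: skip2_cases[OF ad(2)]) metis+
  then obtain t where t: "\<And>x. s (skip2 a d x) = skip2 a d (t x)" by metis
  have s: "s = insert_cycle a d t"
  proof
    fix y show "s y = insert_cycle a d t y"
      using ad sd t by (cases y rule: skip2_cases[OF ad(2)]) auto
  qed
  have "is_involution n t" unfolding is_involution_iff
  proof (intro conjI allI impI)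
    fix x
    have "skip2 a d (t (t x)) = skip2 a d x" using t involution_invol[OF inv] by metis
    then show "t (t x) = x" using ad by simp
    assume "x \<notin> {1..n}"
    then have "skip2 a d x \<notin> {1..n + 2}" using skip2_in_iff a0 ad dn by blast
    then have "skip2 a d (t x) = skip2 a d x" using t involution_outside[OF inv] by metis
    then show "t x = x" using ad by simp
  qed
  then show thesis using that s a0 dn by blast
qed


section \<open>The common recurrence\<close>

text \<open>The parameter \<open>m\<close> says that the first anti-excedance is at least \<open>n + 2 - m\<close>,
  written without truncated subtraction.\<close>

definition inv321 :: "nat \<Rightarrow> nat \<Rightarrow> nat \<Rightarrow> (nat \<Rightarrow> nat) set" where
  "inv321 n j m = {s. is_involution n s \<and> avoids_321 n s \<and> exc n s = j \<and>
     (\<forall>c. s c < c \<longrightarrow> n + 2 \<le> c + m)}"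

definition inv132 :: "nat \<Rightarrow> nat \<Rightarrow> nat \<Rightarrow> (nat \<Rightarrow> nat) set" where
  "inv132 n j m = {s. is_involution n s \<and> avoids_132 n s \<and> exc n s = j \<and> s 1 \<le> m}"

lemma finite_inv321: "finite (inv321 n j m)"
  unfolding inv321_def by (rule finite_involutions)

lemma finite_inv132: "finite (inv132 n j m)"
  unfolding inv132_def by (rule finite_involutions)

section \<open>The 321 side: the 2-cycle through the first anti-excedance\<close>

lemma avoids_321_delete_cycle:
  assumes "is_involution n t" "0 < a" "a < d" "d \<le> n + 2"
    and "avoids_321 (n + 2) (insert_cycle a d t)"
  shows "avoids_321 n t"
proof -
  let ?s = "insert_cycle a d t"
  have "t x < t y" if "x < y" "y \<le> t y" for x y
  proof -
    have "?s (skip2 a d x) < ?s (skip2 a d y)"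
      using assms(5)[unfolded avoids_321_iff[OF insert_cycle_involution[OF assms(1-4)]],
        rule_format, of "skip2 a d x" "skip2 a d y"] that assms(3)
      by simp
    then show ?thesis using assms(3) by simp
  qed
  then show ?thesis by (simp add: avoids_321_iff[OF assms(1)])
qed

text \<open>After insertion, points below \<open>a\<close> are fixed and points strictly between
  \<open>a\<close> and \<open>d\<close> are sent beyond \<open>d\<close>. Hence the new arc is not
  nested with any other and covers no fixed point. An old anti-excedance \<open>c >= d - 1\<close>
  is relabelled to a point beyond \<open>d\<close>, so \<open>d\<close> becomes the first
  one.\<close>

lemma avoids_321_insert_cycle:
  assumes inv: "is_involution n t" and ad: "0 < a" "a < d" "d \<le> n + 2"
    and av: "avoids_321 n t"
    and fixed: "\<And>x. x < a \<Longrightarrow> t x = x" and a: "a + 1 = d \<or> t a \<noteq> a"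
    and cl: "\<And>c. t c < c \<Longrightarrow> d \<le> c + 1"
  shows "avoids_321 (n + 2) (insert_cycle a d t)"
    and "insert_cycle a d t c < c \<Longrightarrow> d \<le> c"
proof -
  let ?s = "insert_cycle a d t"
  have nn: "t x < t y" if "x < y" "y \<le> t y" for x y
    using av that unfolding avoids_321_iff[OF inv] by blast
  have below: "?s x = x" if "x < a" for x
    using insert_cycle_simps(3)[OF ad(2), of t x] fixed[OF that] that by (simp add: skip2_def)
  \<comment> \<open>A fixed \<open>y\<close> here would force \<open>a\<close> to be an excedance of
    \<open>t\<close> with partner below \<open>y\<close>, an anti-excedance that comes too early. So
    \<open>y\<close> is an excedance, and its partner is at least \<open>d - 1\<close>.\<close>
  have mid: "d < ?s x" if "a < x" "x < d" for x
  proof -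
    define y where "y = x - 1"
    have x: "x = skip2 a d y" and y: "a \<le> y" "y + 1 < d" using that by (auto simp: y_def skip2_def)
    have "t y \<noteq> y"
    proof
      assume ty: "t y = y"
      have ta: "t a \<noteq> a" using a y by auto
      then have "a < y" using ty y by (metis le_neq_implies_less)
      have "a < t a" using cl[of a] ta y by force
      moreover have "t a < y" using nn[of a y] \<open>a < y\<close> ty by simp
      ultimately show False using cl[of "t a"] involution_invol[OF inv, of a] y by simp
    qed
    moreover have "\<not> t y < y" using cl[of y] y by auto
    ultimately have "d \<le> t y + 1" using cl[of "t y"] involution_invol[OF inv, of y] by simp
    then have "d < skip2 a d (t y)" using ad by (simp add: skip2_def)
    then show ?thesis using x ad by simp
  qed
  have "?s x < ?s y" if "x < y" "y \<le> ?s y" for x y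
  proof -
    consider "y = d" | "y = a" | "x = d" | "x = a" "y \<noteq> d"
      | x' y' where "x = skip2 a d x'" "y = skip2 a d y'"
      using skip2_cases[OF ad(2)] by metis
    then show ?thesis
    proof cases
      case 1 then show ?thesis using that ad by simp
    next
      case 2 then show ?thesis using that ad below[of x] by simp
    next
      case 3 then show ?thesis using that ad by simp
    next
      case 4 then show ?thesis using that ad mid[of y] by (cases "y < d") auto
    next
      case 5 then show ?thesis using that ad nn by simp
    qed
  qed
  then show "avoids_321 (n + 2) ?s"
    by (simp only: avoids_321_iff[OF insert_cycle_involution[OF inv ad]]) blast
  show "d \<le> c" if "?s c < c"
  proof (rule ccontr)
    assume "\<not> d \<le> c"
    then show False using that below[of c] mid[of c] ad
      by (cases c a rule: linorder_cases) auto
  qed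
qed

lemma card_inv321_rec:
  assumes p: "1 \<le> p" "p \<le> n + 1"
  shows "card (inv321 (n + 2) (Suc j) (Suc p)) = card (inv321 (n + 2) (Suc j) p) + card (inv321 n j p)"
proof -
  \<comment> \<open>At size \<open>n + 2\<close>, parameter \<open>Suc p\<close> admits
    anti-excedances from \<open>d\<close> on and \<open>p\<close> only those beyond
    \<open>d\<close>. At size \<open>n\<close>, parameter \<open>p\<close> admits them from
    \<open>d - 1\<close> on, which is what remains after the relabelling is undone.\<close>
  define d where "d = n + 3 - p"
  have d: "2 \<le> d" "d \<le> n + 2" using p by (auto simp: d_def)
  have dle: "n + 2 + 2 \<le> c + Suc p \<longleftrightarrow> d \<le> c" "n + 2 + 2 \<le> c + p \<longleftrightarrow> d < c"
    "n + 2 \<le> c + p \<longleftrightarrow> d \<le> c + 1" for c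
    using p by (auto simp: d_def)
  define B where "B = {s \<in> inv321 (n + 2) (Suc j) (Suc p). s d < d}"
  have split: "inv321 (n + 2) (Suc j) (Suc p) = inv321 (n + 2) (Suc j) p \<union> B"
    unfolding B_def inv321_def dle by (auto simp: le_less)
  have disj: "inv321 (n + 2) (Suc j) p \<inter> B = {}"
    unfolding B_def inv321_def dle by auto
  \<comment> \<open>the partner of \<open>d\<close> is forced: it must precede all excedances of \<open>t\<close> and not
    leave a fixed point between itself and \<open>d\<close>\<close>
  define pos where "pos t = (LEAST x. x + 1 = d \<or> t x \<noteq> x)" for t :: "nat \<Rightarrow> nat"
  have pos: "pos t < d" "\<And>x. x < pos t \<Longrightarrow> t x = x" "pos t + 1 = d \<or> t (pos t) \<noteq> pos t" for t
  proof -
    have ex: "d - 1 + 1 = d \<or> t (d - 1) \<noteq> d - 1" using d by simp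
    show "pos t + 1 = d \<or> t (pos t) \<noteq> pos t" 
      unfolding pos_def using ex by (rule LeastI)
    have "pos t \<le> d - 1" unfolding pos_def using ex by (rule Least_le)
    then show "pos t < d" using d by simp
    show "t x = x" if "x < pos t" for x using not_less_Least[OF that[unfolded pos_def]] by simp
  qed
  have pos0: "0 < pos t" if "is_involution n t" for t
    using pos(3)[of t] involution_0[OF that] d by (cases "pos t = 0") auto
  have "bij_betw (\<lambda>t. insert_cycle (pos t) d t) (inv321 n j p) B"
    unfolding bij_betw_def
  proof
    show "inj_on (\<lambda>t. insert_cycle (pos t) d t) (inv321 n j p)"
    proof
      fix t t' assume eq: "insert_cycle (pos t) d t = insert_cycle (pos t') d t'"
      \<comment> \<open>The image sends \<open>d\<close> to \<open>pos t\<close>, so the inserted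
        cycle can be read off.\<close>
      then have "pos t = pos t'" using pos(1) insert_cycle_simps(2) by metis
      then show "t = t'" using eq insert_cycle_inject[OF pos(1)] by metis
    qed
    show "(\<lambda>t. insert_cycle (pos t) d t) ` inv321 n j p = B"
    proof
      show "(\<lambda>t. insert_cycle (pos t) d t) ` inv321 n j p \<subseteq> B"
      proof clarify
        fix t assume "t \<in> inv321 n j p"
        then have t: "is_involution n t" "avoids_321 n t" "exc n t = j" "\<And>c. t c < c \<Longrightarrow> d \<le> c + 1"
          unfolding inv321_def dle by auto
        have pos_t: "pos t < d" "\<And>x. x < pos t \<Longrightarrow> t x = x" "pos t + 1 = d \<or> t (pos t) \<noteq> pos t"
          by (rule pos; assumption)+
        show "insert_cycle (pos t) d t \<in> B"
          unfolding B_def inv321_def dle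
          using insert_cycle_involution[OF t(1) pos0[OF t(1)] pos_t(1) d(2)]
            exc_insert_cycle[OF t(1) pos0[OF t(1)] pos_t(1) d(2)]
            avoids_321_insert_cycle[of n t "pos t" d, OF t(1) pos0[OF t(1)] pos_t(1) d(2) t(2) pos_t(2,3) t(4)]
            pos_t(1) t(3)
          by simp
      qed
      show "B \<subseteq> (\<lambda>t. insert_cycle (pos t) d t) ` inv321 n j p"
      proof
        fix s assume "s \<in> B"
        then have s: "is_involution (n + 2) s" "avoids_321 (n + 2) s" "exc (n + 2) s = Suc j"
          "\<And>c. s c < c \<Longrightarrow> d \<le> c" "s d < d"
          unfolding B_def inv321_def dle by auto
        define a where "a = s d"
        have ad: "s a = d" "a < d" using s involution_invol[OF s(1)] by (auto simp: a_def)
        obtain t where t: "is_involution n t" "s = insert_cycle a d t" "0 < a"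
          using delete_cycle[OF s(1) ad] by blast
        have st: "s (skip2 a d x) = skip2 a d (t x)" for x using t(2) ad(2) by simp
        have nn: "s x < s y" if "x < y" "y \<le> s y" for x y
          using s(2) that unfolding avoids_321_iff[OF s(1)] by blast
        have av: "avoids_321 n t"
          using avoids_321_delete_cycle[OF t(1,3) ad(2) d(2)] s(2) t(2) by simp
        have ex: "exc n t = j" using exc_insert_cycle[OF t(1,3) ad(2) d(2)] s(3) t(2) by simp
        have cl: "d \<le> c + 1" if "t c < c" for c
        proof -
          have "d \<le> skip2 a d c" using s(4)[of "skip2 a d c"] st that ad by simp
          moreover have "skip2 a d c \<noteq> d" using ad by simp
          ultimately show ?thesis by (auto simp: skip2_def split: if_splits)
        qed
        \<comment> \<open>A moved point \<open>x < a\<close> would be an excedance whose partner is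
          at least \<open>d\<close>, so its arc would enclose that of \<open>a\<close>.\<close>
        have fixed: "t x = x" if "x < a" for x
        proof (rule ccontr)
          assume ne: "t x \<noteq> x"
          have "\<not> t x < x" using cl[of x] that ad by auto
          then have "x < s x" using ne st[of x] skip2_less_iff[OF ad(2), of x "t x"] that
            by (simp add: skip2_def split: if_splits)
          then have "d \<le> s x" using s(4)[of "s x"] involution_invol[OF s(1), of x] by simp
          then show False using nn[of x a] that ad by simp
        qed
        \<comment> \<open>Otherwise \<open>a + 1\<close> would be a fixed point of \<open>s\<close>
          below the arc from \<open>a\<close> to \<open>d\<close>.\<close>
        have "t a \<noteq> a" if "a + 1 \<noteq> d"
        proof
          assume "t a = a"
          then have "s (a + 1) = a + 1" using st[of a] that ad by (simp add: skip2_def)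
          then show False using nn[of a "a + 1"] ad by simp
        qed
        then have "pos t = a" unfolding pos_def
          by (intro Least_equality) (use fixed ad in \<open>force simp: not_less[symmetric]\<close>)+
        then show "s \<in> (\<lambda>t. insert_cycle (pos t) d t) ` inv321 n j p"
          unfolding inv321_def dle using t av ex cl by auto
      qed
    qed
  qed
  then have "card (inv321 n j p) = card B" by (rule bij_betw_same_card)
  moreover have "finite B" unfolding B_def using finite_inv321 by simp
  ultimately show ?thesis
    unfolding split using card_Un_disjoint[OF finite_inv321 _ disj] by simp
qed

section \<open>The 132 side: the 2-cycle through 1\<close>

text \<open>With \<open>m\<close> as first value, the values above \<open>m\<close> must appear in
  increasing order. They come from the values of \<open>t\<close> that are at least
  \<open>m - 1\<close>; if \<open>t\<close> avoids 132 and \<open>t 1 < m\<close>, then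
  \<open>t 1\<close> in front already forces these to increase.\<close>

lemma avoids_132_insert_cycle_iff:
  assumes inv: "is_involution n t" and m: "1 < m" "m \<le> n + 2"
  shows "avoids_132 (n + 2) (insert_cycle 1 m t) \<longleftrightarrow> avoids_132 n t \<and> t 1 < m"
proof -
  let ?s = "insert_cycle 1 m t" and ?f = "skip2 1 m"
  have sinv: "is_involution (n + 2) ?s" by (rule insert_cycle_involution[OF inv _ m]) simp
  have f0: "?f x = 0 \<longleftrightarrow> x = 0" for x by (auto simp: skip2_def)
  have f_gt: "m < ?f x \<longleftrightarrow> m \<le> x + 1" if "0 < x" for x using that m by (auto simp: skip2_def)
  have t0: "0 < t x" if "0 < x" for x
    using that involution_eq_iff[OF inv, of x 0] involution_0[OF inv] by auto
  show ?thesis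
  proof
    assume "avoids_132 (n + 2) ?s"
    then have av: "?s y \<le> ?s z" if "0 < x" "x < y" "y < z" "?s x < ?s z" for x y z
      using that avoids_132_iff[OF sinv] by blast
    have "t y \<le> t z" if "0 < x" "x < y" "y < z" "t x < t z" for x y z
      using av[of "?f x" "?f y" "?f z"] that m f0[of x] by simp
    moreover have "t 1 < m"
    proof (rule ccontr)
      assume t1: "\<not> t 1 < m"
      \<comment> \<open>\<open>z\<close> is the position of the value \<open>m - 1\<close> in
        \<open>t\<close>, which insertion turns into \<open>m + 1\<close>. The entry from position 1
        of \<open>t\<close> precedes it and would be larger, giving a 132 pattern that starts with
        \<open>m\<close>.\<close>
      define z where "z = t (m - 1)"
      have "?f (m - 1) = m + 1" using m by (simp add: skip2_def)
      then have sz: "?s (?f z) = m + 1"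
        using m involution_invol[OF inv] by (simp add: z_def)
      have "z \<noteq> 1" using t1 m involution_invol[OF inv, of "m - 1"] by (auto simp: z_def)
      moreover have "0 < z" using t0 m by (simp add: z_def)
      ultimately have "1 < z" by simp
      moreover have "1 < ?f 1" using m by (simp add: skip2_def)
      ultimately have "?s (?f 1) \<le> ?s (?f z)"
        by (intro av[of 1]) (use sz m \<open>1 < z\<close> in simp_all)
      then have "?f (t 1) \<le> m + 1" 
        using sz insert_cycle_simps(3)[OF m(1)] by metis
      then show False using t1 m(1) by (simp add: skip2_def split: if_splits)
    qed
    ultimately show "avoids_132 n t \<and> t 1 < m" by (simp add: avoids_132_iff[OF inv])
  next
    assume R: "avoids_132 n t \<and> t 1 < m"
    then have av: "t y \<le> t z" if "0 < x" "x < y" "y < z" "t x < t z" for x y z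
      using that avoids_132_iff[OF inv] by blast
    have incr_t: "t x < t y" if "0 < x" "x < y" "m \<le> t x + 1" "m \<le> t y + 1" for x y
    proof -
      have "t 1 \<noteq> t y" using that involution_eq_iff[OF inv] by force
      then have "t 1 < t y" using R that by simp
      then have "t x \<le> t y" using av[of 1 x y] that by (cases "x = 1") auto
      then show ?thesis using that involution_eq_iff[OF inv, of x y] by (auto simp: le_less)
    qed
    have incr: "?s x < ?s y" if "0 < x" "x < y" "m < ?s x" "m < ?s y" for x y
    proof -
      have "x \<noteq> 1" "x \<noteq> m" "y \<noteq> 1" "y \<noteq> m" using that m by auto
      then obtain x' y' where xy: "x = ?f x'" "y = ?f y'"
        using skip2_cases[OF m(1)] by metis
      then have "0 < x'" "x' < y'" using that(1,2) m f0[of x'] by auto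
      moreover have "m < ?f (t x')" "m < ?f (t y')" using that(3,4) xy m by auto
      ultimately have "t x' < t y'" using incr_t[of x' y'] t0 f_gt by auto
      then show ?thesis using xy m by simp
    qed
    have "?s y \<le> ?s z" if xyz: "0 < x" "x < y" "y < z" "?s x < ?s z" for x y z
    proof (rule ccontr)
      assume lt: "\<not> ?s y \<le> ?s z"
      have s1: "?s 1 = m" "?s m = 1" using m by auto
      have spos: "0 < ?s x" "0 < ?s z"
        using xyz involution_eq_iff[OF sinv, of x 0] involution_0[OF sinv] by auto
      consider "x = 1" | "x = m" | "y = m" | "z = m" | "y = 1" | "z = 1"
        | x' y' z' where "x = ?f x'" "y = ?f y'" "z = ?f z'"
        using skip2_cases[OF m(1)] by metis
      then show False
      proof cases
        case 1 then show False using incr[of y z] xyz lt s1 by simp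
      next
        case 2
        \<comment> \<open>Here \<open>y\<close> and \<open>z\<close> exceed \<open>m\<close>. Read
          as positions, \<open>?s z < ?s y\<close> carry the values \<open>z\<close> and
          \<open>y\<close>, so \<open>incr\<close> gives \<open>z < y\<close>.\<close>
        have "?s z < ?s y" using lt by simp
        moreover have "?s (?s y) = y" "?s (?s z) = z" using involution_invol[OF sinv] by auto
        ultimately show False using incr[of "?s z" "?s y"] xyz 2 spos by simp
      next
        case 7
        then show False using av[of x' y' z'] xyz lt m f0[of x'] by simp
      qed (use xyz lt s1 spos in auto)
    qed
    then show "avoids_132 (n + 2) ?s" by (simp only: avoids_132_iff[OF sinv]) blast
  qed
qed

text \<open>The new members are those with \<open>s 1 = Suc p\<close>. Deleting the cycle through 1
  leaves the condition \<open>t 1 < Suc p\<close>, which is exactly the bound defining the smaller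
  class.\<close>

lemma card_inv132_rec:
  assumes p: "1 \<le> p" "p \<le> n + 1"
  shows "card (inv132 (n + 2) (Suc j) (Suc p)) = card (inv132 (n + 2) (Suc j) p) + card (inv132 n j p)"
proof -
  define B where "B = {s \<in> inv132 (n + 2) (Suc j) (Suc p). s 1 = Suc p}"
  have m: "1 < Suc p" "Suc p \<le> n + 2" using p by auto
  have split: "inv132 (n + 2) (Suc j) (Suc p) = inv132 (n + 2) (Suc j) p \<union> B"
    and disj: "inv132 (n + 2) (Suc j) p \<inter> B = {}"
    unfolding B_def inv132_def by auto
  have "bij_betw (insert_cycle 1 (Suc p)) (inv132 n j p) B"
    unfolding bij_betw_def
  proof
    show "inj_on (insert_cycle 1 (Suc p)) (inv132 n j p)"
      using insert_cycle_inject[OF m(1)] by (auto intro: inj_onI)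
    show "insert_cycle 1 (Suc p) ` inv132 n j p = B"
    proof
      show "insert_cycle 1 (Suc p) ` inv132 n j p \<subseteq> B"
        unfolding B_def inv132_def
        using insert_cycle_involution[OF _ zero_less_one m] exc_insert_cycle[OF _ zero_less_one m]
          avoids_132_insert_cycle_iff[OF _ m] m
        by auto
      show "B \<subseteq> insert_cycle 1 (Suc p) ` inv132 n j p"
      proof
        fix s assume "s \<in> B"
        then have s: "is_involution (n + 2) s" "avoids_132 (n + 2) s" "exc (n + 2) s = Suc j"
          "s 1 = Suc p" unfolding B_def inv132_def by auto
        obtain t where t: "is_involution n t" "s = insert_cycle 1 (Suc p) t"
          using delete_cycle[OF s(1,4) m(1)] by blast
        then have "t \<in> inv132 n j p"
          using s exc_insert_cycle[OF t(1) zero_less_one m] avoids_132_insert_cycle_iff[OF t(1) m]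
          by (auto simp: inv132_def)
        then show "s \<in> insert_cycle 1 (Suc p) ` inv132 n j p" using t by blast
      qed
    qed
  qed
  then have "card (inv132 n j p) = card B" by (rule bij_betw_same_card)
  moreover have "finite B" unfolding B_def using finite_inv132 by simp
  ultimately show ?thesis
    unfolding split using card_Un_disjoint[OF finite_inv132 _ disj] by simp
qed

section \<open>Boundary values and the induction\<close>

lemma is_involution_id: "is_involution n id"
  by (simp add: is_involution_iff)

lemma inv321_inv132_0:
  assumes "1 \<le> m" shows "inv321 n 0 m = inv132 n 0 m"
proof -
  have "inv321 n 0 m = {id}" 
    unfolding inv321_def using is_involution_id exc_eq_0_iff by (auto simp: avoids_321_def)
  moreover have "inv132 n 0 m = {id}" 
    unfolding inv132_def using is_involution_id exc_eq_0_iff assms by (auto simp: avoids_132_def)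
  ultimately show ?thesis by simp
qed

text \<open>Parameter 1 excludes every anti-excedance in \<open>{1..n}\<close> on the 321 side. On
  the 132 side it makes 1 a fixed point, so the rank, and with it the number of excedances, is
  0.\<close>

lemma inv321_inv132_1:
  shows "inv321 n (Suc j) 1 = {}" "inv132 n (Suc j) 1 = {}"
proof -
  have False if "s \<in> inv321 n (Suc j) 1" for s
  proof -
    have s: "is_involution n s" "exc n s = Suc j" "\<And>c. s c < c \<Longrightarrow> n < c"
      using that by (auto simp: inv321_def)
    have "{x \<in> {1..n}. s x < x} = {}" using s(3) by force
    then show False using card_anti_exc[OF s(1)] s(2) by (metis card.empty nat.distinct(1))
  qed
  then show "inv321 n (Suc j) 1 = {}" by blast
  have False if "s \<in> inv132 n (Suc j) 1" for s
  proof -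
    have s: "is_involution n s" "exc n s = Suc j" "avoids_132 n s" "s 1 \<le> 1"
      using that by (auto simp: inv132_def)
    have "s 1 \<noteq> 0" using involution_0[OF s(1)] involution_eq_iff[OF s(1), of 1 0] by simp
    then have s1: "s 1 = 1" using s by simp
    have "rk n s \<noteq> 0" using rk_132[OF s(1,3)] s(2) by simp
    moreover have "rk n s = 0" unfolding rk_def
      by (rule Max_eqI) (use s1 in force)+
    ultimately show False by simp
  qed
  then show "inv132 n (Suc j) 1 = {}" by blast
qed

text \<open>An anti-excedance is at least 2, because its image is at least 1; so the bound is
  already vacuous at parameter \<open>n\<close>.\<close>

lemma inv321_top: "1 \<le> n \<Longrightarrow> inv321 n j (Suc n) = inv321 n j n"
proof -
  have "n + 2 \<le> c + n" if "is_involution n s" "s c < c" for s c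
    using that involution_in_iff[OF that(1), of c] involution_outside[OF that(1), of c] by force
  then show ?thesis by (force simp: inv321_def)
qed

lemma inv132_top: "1 \<le> n \<Longrightarrow> inv132 n j (Suc n) = inv132 n j n"
proof -
  assume "1 \<le> n"
  then have "s 1 \<le> n" if "is_involution n s" for s
    using involution_in_iff[OF that, of 1] by simp
  then show ?thesis by (force simp: inv132_def)
qed

lemma card_inv321_eq_inv132:
  "1 \<le> m \<Longrightarrow> m \<le> Suc n \<Longrightarrow> card (inv321 n j m) = card (inv132 n j m)"
proof (induction n arbitrary: j m rule: less_induct)
  case (less n)
  show ?case
  proof (cases j)
    case 0
    then show ?thesis using inv321_inv132_0 less.prems by simp
  next
    case (Suc i)
    \<comment> \<open>The recurrence reaches parameters up to \<open>n\<close>; \<open>max\<close>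
      keeps the base case \<open>m = 1\<close> available at \<open>n = 0\<close>. Parameter
      \<open>Suc n\<close> is reduced to \<open>n\<close> afterwards.\<close>
    have main: "card (inv321 n j m) = card (inv132 n j m)" if "1 \<le> m" "m \<le> max 1 n" for m
      using that
    proof (induction m rule: nat_induct_at_least)
      case base
      show ?case using Suc inv321_inv132_1 by simp
    next
      case (Suc p)
      \<comment> \<open>\<open>Suc p <= max 1 n\<close> with \<open>p >= 1\<close> gives
        \<open>n >= 2\<close>, so the subtraction is exact.\<close>
      define k where "k = n - 2"
      have n: "n = k + 2" "p \<le> k + 1" using Suc by (auto simp: k_def)
      have "card (inv321 k i p) = card (inv132 k i p)" using less.IH[of k p i] n Suc.hyps by simp
      moreover have "card (inv321 n j p) = card (inv132 n j p)" using Suc by simp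
      ultimately show ?case unfolding \<open>j = Suc i\<close> n(1)
        using card_inv321_rec[OF Suc.hyps(1) n(2), of i] card_inv132_rec[OF Suc.hyps(1) n(2), of i]
        by simp
    qed
    show ?thesis
    proof (cases "m = Suc n \<and> 1 \<le> n")
      case True
      then show ?thesis using main[of n] inv321_top inv132_top by simp
    next
      case False
      then show ?thesis using main[of m] less.prems by auto
    qed
  qed
qed

theorem theorem4:
  fixes n i j k :: nat
  assumes "n \<ge> 1" and "i \<le> n" and "j \<le> n" and "k \<le> n"
  shows "card {s. is_involution n s \<and> avoids_321 n s \<and> fp n s = i \<and> exc n s = j \<and> lis n s = k}
       = card {s. is_involution n s \<and> avoids_132 n s \<and> fp n s = i \<and> exc n s = j \<and> rk n s = n - k}"
proof -
  \<comment> \<open>The value \<open>j\<close> of \<open>exc\<close> determines \<open>fp\<close>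
    and \<open>lis\<close>: either \<open>i\<close> and \<open>k\<close> fit and the whole class
    remains, or the set is empty. At parameter \<open>Suc n\<close> the bound in
    \<open>inv321\<close> is vacuous.\<close>
  have "{s. is_involution n s \<and> avoids_321 n s \<and> fp n s = i \<and> exc n s = j \<and> lis n s = k}
      = (if i + 2 * j = n \<and> k = n - j then inv321 n j (Suc n) else {})"
  proof -
    have "n + 2 \<le> c + Suc n" if "s c < c" for s :: "nat \<Rightarrow> nat" and c using that by simp
    then show ?thesis using fp_exc lis_321 by (force simp: inv321_def)
  qed
  \<comment> \<open>For \<open>j\<close> and \<open>k\<close> at most \<open>n\<close>, the rank
    condition \<open>j = n - k\<close> is the same as \<open>k = n - j\<close>.\<close>
  moreover have "{s. is_involution n s \<and> avoids_132 n s \<and> fp n s = i \<and> exc n s = j \<and> rk n s = n - k}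
      = (if i + 2 * j = n \<and> k = n - j then inv132 n j (Suc n) else {})"
  proof -
    have "s 1 \<le> Suc n" if "is_involution n s" for s
      using that involution_in_iff[OF that, of 1] assms(1) by simp
    then show ?thesis using fp_exc rk_132 assms by (force simp: inv132_def)
  qed
  ultimately show ?thesis using card_inv321_eq_inv132[of "Suc n" n j] by simp
qed

end
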